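(* Let $n$ and $r$ be positive integers with $n \ge r$, and let $(A; A_1,\ldots,A_r)$ be a complete partitioned alphabet. Then: (i) (General case) The set of all partition-level GRL vectors of length $n$ over $(A;A_1,\ldots,A_r)$ has cardinality $r^n$. (ii) (Surjective case) The set of partition-level GRL vectors of length $n$ over $(A;A_1,\ldots,A_r)$ in which all $r$ subsets $A_1,\ldots,A_r$ appear at least once has cardinality $$\sum_{i=0}^{r-1} (-1)^i \binom{r}{i}(r-i)^n = r!\cdot S(n,r),$$ where $S(n,r)$ is the Stirling number of the second kind. (iii) (Balanced case) Write $n = qr+s$ with $q=\lfloor n/r\rfloor$ and $0\le s<r$. The set of balanced partition-level GRL vectors of length $n$, i.e. those in which exactly $s$ of the subsets $A_1,\ldots,A_r$ appear $q+1$ times and the remaining $r-s$ subsets appear $q$ times, has cardinality $$\binom{r}{s}\cdot \frac{n!}{\big((q+1)!\big)^{s}\,\big(q!\big)^{r-s}}.$$ When $r$ divides $n$ (i.e. $s=0$), this reduces to $\dfrac{n!}{(q!)^r}$ with $q=n/r$.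
   Context: Partitioned alphabet: let $A$ be a finite alphabet. A collection $\{A_1,\ldots,A_r\}$ of non-empty, pairwise disjoint subsets of $A$ is called a partitioned alphabet, written $(A;A_1,\ldots,A_r)$. It is complete if $\bigcup_{i=1}^r A_i = A$. Partition-level GRL (generalized run-length) vector over $(A;A_1,\ldots,A_r)$: a finite sequence $$v=((A_{i_1},s_1),(A_{i_2},s_2),\ldots,(A_{i_m},s_m))$$ where each $i_j\in\{1,\ldots,r\}$, each $s_j$ is a positive integer (the run length), and $i_j\ne i_{j+1}$ for all $j=1,\ldots,m-1$. The number of runs $m$ is not fixed. The length of $v$ is $s_1+\cdots+s_m$. The pair $(A_{i_j},s_j)$ represents $s_j$ consecutive positions labelled by the subset $A_{i_j}$. Accordingly, the number of times a subset $A_i$ appears in $v$ is the total $\sum_{j:\, i_j=i} s_j$ of the lengths of the runs labelled $A_i$; in particular $A_i$ appears at least once iff some $i_j = i$. *)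

theory Defs
  imports Complex_Main "HOL-Combinatorics.Stirling" "HOL-Library.Disjoint_Sets"
begin

text \<open>The subsets \<open>A\<^sub>1, \<dots>, A\<^sub>r\<close> are the values of \<open>As\<close> on \<open>{1..r}\<close>; values of \<open>As\<close>
  at other indices are irrelevant.\<close>

definition partitioned_alphabet :: "'a set \<Rightarrow> nat \<Rightarrow> (nat \<Rightarrow> 'a set) \<Rightarrow> bool" where
  "partitioned_alphabet A r As \<longleftrightarrow>
     finite A \<and>
     (\<forall>i\<in>{1..r}. As i \<noteq> {} \<and> As i \<subseteq> A) \<and>
     disjoint_family_on As {1..r}"

definition complete_partitioned_alphabet :: "'a set \<Rightarrow> nat \<Rightarrow> (nat \<Rightarrow> 'a set) \<Rightarrow> bool" where
  "complete_partitioned_alphabet A r As \<longleftrightarrow>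
     partitioned_alphabet A r As \<and> (\<Union>i\<in>{1..r}. As i) = A"

text \<open>A vector is the list of its runs \<open>(A\<^bsub>i\<^sub>j\<^esub>, s\<^sub>j)\<close>, labelled by the subsets themselves.
  The list \<open>ix\<close> is the index sequence \<open>i\<^sub>1, \<dots>, i\<^sub>m\<close>; for a partitioned alphabet it is determined
  by the vector, as non-empty pairwise disjoint subsets are distinct.\<close>

definition grl_vector :: "nat \<Rightarrow> (nat \<Rightarrow> 'a set) \<Rightarrow> ('a set \<times> nat) list \<Rightarrow> bool" where
  "grl_vector r As v \<longleftrightarrow>
     (\<exists>ix :: nat list. length ix = length v \<and>
        (\<forall>j<length v. ix ! j \<in> {1..r} \<and> fst (v ! j) = As (ix ! j) \<and> 0 < snd (v ! j)) \<and>
        (\<forall>j. Suc j < length v \<longrightarrow> ix ! j \<noteq> ix ! Suc j))"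

definition grl_length :: "('a set \<times> nat) list \<Rightarrow> nat" where
  "grl_length v = (\<Sum>j<length v. snd (v ! j))"

definition appearances :: "('a set \<times> nat) list \<Rightarrow> 'a set \<Rightarrow> nat" where
  "appearances v B = (\<Sum>j | j < length v \<and> fst (v ! j) = B. snd (v ! j))"

definition grl_vectors :: "nat \<Rightarrow> (nat \<Rightarrow> 'a set) \<Rightarrow> nat \<Rightarrow> ('a set \<times> nat) list set" where
  "grl_vectors r As n = {v. grl_vector r As v \<and> grl_length v = n}"

definition surjective_grl_vectors :: "nat \<Rightarrow> (nat \<Rightarrow> 'a set) \<Rightarrow> nat \<Rightarrow> ('a set \<times> nat) list set" where
  "surjective_grl_vectors r As n =
     {v \<in> grl_vectors r As n. \<forall>i\<in>{1..r}. 1 \<le> appearances v (As i)}"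

text \<open>The parameters \<open>q\<close> and \<open>s\<close> are meant to be the quotient and remainder of \<open>n\<close> by \<open>r\<close>.\<close>

definition balanced_grl_vectors ::
  "nat \<Rightarrow> (nat \<Rightarrow> 'a set) \<Rightarrow> nat \<Rightarrow> nat \<Rightarrow> nat \<Rightarrow> ('a set \<times> nat) list set" where
  "balanced_grl_vectors r As n q s =
     {v \<in> grl_vectors r As n.
        \<exists>I\<subseteq>{1..r}. card I = s \<and>
          (\<forall>i\<in>I. appearances v (As i) = q + 1) \<and>
          (\<forall>i\<in>{1..r} - I. appearances v (As i) = q)}"

end

theory Submission
  imports Defs "HOL-Combinatorics.Multiset_Permutations"
begin

text \<open>Writing every run out in full is a bijection from the vectors of length \<open>n\<close> onto the words of
  length \<open>n\<close> over the \<open>r\<close> letters \<open>A\<^sub>1, \<dots>, A\<^sub>r\<close>, with run-length encoding as inverse; it turns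
  appearances into letter counts. The three cases count all words, the surjective words, and the
  arrangements of a multiset, summed over the choice of the letters used \<open>q + 1\<close> times. The number
  of surjective words and the alternating sum are both identified with \<open>r! S(n, r)\<close> through the
  common recurrence \<open>T(n+1, r) = r (T(n, r) + T(n, r-1))\<close>.\<close>

section \<open>Run-length encoding of words and its inverse\<close>

definition expand_runs :: "('b \<times> nat) list \<Rightarrow> 'b list" where
  "expand_runs v = concat (map (\<lambda>(x, k). replicate k x) v)"

fun run_length_encode :: "'b list \<Rightarrow> ('b \<times> nat) list" where
  "run_length_encode [] = []"
| "run_length_encode (x # xs) =
     (case run_length_encode xs of
        [] \<Rightarrow> [(x, 1)]
      | (y, k) # v \<Rightarrow> if x = y then (y, Suc k) # v else (x, 1) # (y, k) # v)"

text \<open>The normal form on which encoding inverts expansion. It collects the conditions on a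
  vector that do not refer to the index list, so the bijection can be set up for arbitrary
  labels.\<close>

definition reduced_runs :: "('b \<times> nat) list \<Rightarrow> bool" where
  "reduced_runs v \<longleftrightarrow> distinct_adj (map fst v) \<and> (\<forall>p\<in>set v. 0 < snd p)"

lemma expand_runs_simps [simp]:
  "expand_runs [] = []"
  "expand_runs ((x, k) # v) = replicate k x @ expand_runs v"
  by (simp_all add: expand_runs_def)

lemma reduced_runs_Nil [simp]: "reduced_runs []"
  by (simp add: reduced_runs_def)

lemma reduced_runs_Cons:
  "reduced_runs ((x, k) # v) \<longleftrightarrow> 0 < k \<and> (v = [] \<or> x \<noteq> fst (hd v)) \<and> reduced_runs v"
  by (auto simp: reduced_runs_def distinct_adj_Cons hd_map)

lemma expand_run_length_encode [simp]: "expand_runs (run_length_encode w) = w"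
  by (induction w) (auto split: list.splits)

lemma reduced_run_length_encode [simp]: "reduced_runs (run_length_encode w)"
  by (induction w) (auto simp: reduced_runs_Cons split: list.splits)

text \<open>The condition on \<open>x\<close> keeps the new block from merging with the first run of
  \<open>v\<close>: its last letter opens a run of length 1, and each further copy of
  \<open>x\<close> lengthens that run.\<close>

lemma run_length_encode_replicate_append:
  assumes "0 < k" "v = [] \<or> x \<noteq> fst (hd v)" "run_length_encode w = v"
  shows "run_length_encode (replicate k x @ w) = (x, k) # v"
  using assms(1)
proof (induction k)
  case (Suc k)
  then show ?case
    using assms(2,3) by (cases k) (auto split: list.splits)
qed simp

lemma run_length_encode_expand: "reduced_runs v \<Longrightarrow> run_length_encode (expand_runs v) = v"
proof (induction v)
  case (Cons p v)
  then show ?case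
    by (cases p) (simp add: reduced_runs_Cons run_length_encode_replicate_append)
qed simp

text \<open>Positivity of the run lengths matters: a run of length 0 would contribute a label but no
  letter.\<close>

lemma set_expand_runs: "reduced_runs v \<Longrightarrow> set (expand_runs v) = fst ` set v"
  by (force simp: expand_runs_def reduced_runs_def)

section \<open>From vectors to words\<close>

lemma grl_length_expand: "grl_length v = length (expand_runs v)"
proof -
  have "grl_length v = sum_list (map snd v)"
    by (simp add: grl_length_def sum_list_sum_nth lessThan_atLeast0)
  also have "\<dots> = length (expand_runs v)"
    by (induction v) auto
  finally show ?thesis .
qed

lemma appearances_expand: "appearances v B = count_list (expand_runs v) B"
proof -
  have "appearances v B = (\<Sum>j<length v. if fst (v ! j) = B then snd (v ! j) else 0)"
    unfolding appearances_def by (rule sum.mono_neutral_cong_left) auto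
  also have "\<dots> = sum_list (map (\<lambda>p. if fst p = B then snd p else 0) v)"
    by (simp add: sum_list_sum_nth lessThan_atLeast0)
  also have "\<dots> = count_list (expand_runs v) B"
  proof (induction v)
    case (Cons p v)
    have "count_list (replicate k x) B = (if x = B then k else 0)" for k x
      by (induction k) auto
    with Cons show ?case by (cases p) simp
  qed simp
  finally show ?thesis .
qed

text \<open>Injectivity turns distinct neighbouring indices into distinct neighbouring labels.
  Conversely, preimages of the labels under \<open>As\<close> serve as the index list, and equal
  neighbouring indices would force equal labels.\<close>

lemma grl_vector_iff:
  assumes "inj_on As {1..r}"
  shows "grl_vector r As v \<longleftrightarrow> reduced_runs v \<and> fst ` set v \<subseteq> As ` {1..r}"
proof
  assume "grl_vector r As v"
  then obtain ix where ix: "length ix = length v"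
    "\<And>j. j < length v \<Longrightarrow> ix ! j \<in> {1..r} \<and> fst (v ! j) = As (ix ! j) \<and> 0 < snd (v ! j)"
    "\<And>j. Suc j < length v \<Longrightarrow> ix ! j \<noteq> ix ! Suc j"
    unfolding grl_vector_def by blast
  have "fst (v ! j) \<noteq> fst (v ! Suc j)" if "Suc j < length v" for j
    using ix(2)[of j] ix(2)[of "Suc j"] ix(3)[of j] that inj_on_eq_iff[OF assms]
    by simp
  moreover have "0 < snd p \<and> fst p \<in> As ` {1..r}" if p: "p \<in> set v" for p
  proof -
    obtain j where "j < length v" "p = v ! j"
      using p by (auto simp: in_set_conv_nth)
    then show ?thesis using ix(2)[of j] by simp
  qed
  ultimately show "reduced_runs v \<and> fst ` set v \<subseteq> As ` {1..r}"
    by (auto simp: reduced_runs_def distinct_adj_conv_nth)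
next
  assume v: "reduced_runs v \<and> fst ` set v \<subseteq> As ` {1..r}"
  define ix where "ix = map (\<lambda>p. inv_into {1..r} As (fst p)) v"
  have mem: "fst (v ! j) \<in> As ` {1..r}" if "j < length v" for j
    using v that by auto
  have *: "ix ! j \<in> {1..r} \<and> fst (v ! j) = As (ix ! j)" if "j < length v" for j
    using inv_into_into[OF mem[OF that]] f_inv_into_f[OF mem[OF that]] that
    by (simp add: ix_def)
  have "ix ! j \<noteq> ix ! Suc j" if "Suc j < length v" for j
  proof -
    have "fst (v ! j) \<noteq> fst (v ! Suc j)"
      using v that by (auto simp: reduced_runs_def distinct_adj_conv_nth)
    then show ?thesis
      using *[of j] *[of "Suc j"] that by auto
  qed
  moreover have "0 < snd (v ! j)" if "j < length v" for j
    using v that by (auto simp: reduced_runs_def)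
  moreover have "length ix = length v"
    by (simp add: ix_def)
  ultimately show "grl_vector r As v"
    unfolding grl_vector_def using * by blast
qed

text \<open>The predicate \<open>P\<close> on the counting function lets a single bijection serve
  all three cases: it is instantiated with the trivial, the surjective and the balanced
  condition.\<close>

lemma bij_betw_expand_runs:
  assumes "inj_on As {1..r}"
  shows "bij_betw expand_runs
     {v \<in> grl_vectors r As n. P (appearances v)}
     {w. set w \<subseteq> As ` {1..r} \<and> length w = n \<and> P (count_list w)}"
proof (rule bij_betw_byWitness[where f' = run_length_encode])
  show "run_length_encode ` {w. set w \<subseteq> As ` {1..r} \<and> length w = n \<and> P (count_list w)}
      \<subseteq> {v \<in> grl_vectors r As n. P (appearances v)}"
  proof (rule image_subsetI)
    fix w assume w: "w \<in> {w. set w \<subseteq> As ` {1..r} \<and> length w = n \<and> P (count_list w)}"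
    have "appearances (run_length_encode w) = count_list w"
      by (simp add: fun_eq_iff appearances_expand)
    moreover have "fst ` set (run_length_encode w) = set w"
      using set_expand_runs[of "run_length_encode w"] by simp
    ultimately show "run_length_encode w \<in> {v \<in> grl_vectors r As n. P (appearances v)}"
      using w by (simp add: grl_vectors_def grl_vector_iff[OF assms] grl_length_expand)
  qed
  have "appearances v = count_list (expand_runs v)" for v :: "('a set \<times> nat) list"
    by (simp add: fun_eq_iff appearances_expand)
  then show "expand_runs ` {v \<in> grl_vectors r As n. P (appearances v)}
      \<subseteq> {w. set w \<subseteq> As ` {1..r} \<and> length w = n \<and> P (count_list w)}"
    by (auto simp: grl_vectors_def grl_vector_iff[OF assms] grl_length_expand set_expand_runs)
qed (auto simp: grl_vectors_def grl_vector_iff[OF assms] run_length_encode_expand)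

section \<open>Surjective words, the alternating sum and Stirling numbers\<close>

text \<open>Removing the first letter \<open>x\<close> from a word with letter set \<open>S\<close>
  leaves a word with letter set \<open>S\<close> or \<open>S - {x}\<close>, according to whether
  \<open>x\<close> occurs again. Summing over \<open>x\<close> gives the recurrence.\<close>

lemma card_lists_set_eq:
  assumes "finite S"
  shows "card {w. length w = n \<and> set w = S} = fact (card S) * Stirling n (card S)"
  using assms
proof (induction n arbitrary: S)
  case 0
  \<comment> \<open>The empty word has letter set \<open>S\<close> only for empty \<open>S\<close>,
    in agreement with \<open>Stirling 0 0 = 1\<close> and
    \<open>Stirling 0 (Suc k) = 0\<close>.\<close>
  have "{w. length w = 0 \<and> set w = S} = (if S = {} then {[]} else {})"
    by auto
  then have "card {w. length w = 0 \<and> set w = S} = (if S = {} then 1 else 0)"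
    by simp
  with 0 show ?case
    by (cases "card S") (simp_all add: card_eq_0_iff split: if_splits)
next
  case (Suc n)
  define L where "L T = {w. length w = n \<and> set w = T}" for T :: "'a set"
  have fin: "finite (L T)" if "finite T" for T
    by (rule finite_subset[OF _ finite_lists_length_eq[OF that, of n]]) (auto simp: L_def)
  have eq: "{w. length w = Suc n \<and> set w = S} = (\<Union>x\<in>S. (#) x ` (L S \<union> L (S - {x})))"
  proof (intro equalityI subsetI)
    fix w assume "w \<in> {w. length w = Suc n \<and> set w = S}"
    then obtain x u where w: "w = x # u" "length u = n" "insert x (set u) = S"
      by (auto simp: length_Suc_conv)
    from w(3) have "set u = S \<or> set u = S - {x}" and "x \<in> S" by blast+
    moreover from this w(2) have "u \<in> L S \<union> L (S - {x})"
      unfolding L_def by blast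
    ultimately show "w \<in> (\<Union>x\<in>S. (#) x ` (L S \<union> L (S - {x})))"
      unfolding w(1) by (intro UN_I[of x] imageI[where f = "(#) x"])
  next
    fix w assume "w \<in> (\<Union>x\<in>S. (#) x ` (L S \<union> L (S - {x})))"
    then obtain x u where "x \<in> S" "w = x # u" "u \<in> L S \<union> L (S - {x})"
      by blast
    then show "w \<in> {w. length w = Suc n \<and> set w = S}"
      unfolding L_def by (elim UnE) (simp_all add: insert_absorb)
  qed
  show ?case
  proof (cases "card S")
    case 0
    then show ?thesis using Suc.prems by (auto simp: card_eq_0_iff)
  next
    case c: (Suc k)
    have "card {w. length w = Suc n \<and> set w = S} = (\<Sum>x\<in>S. card ((#) x ` (L S \<union> L (S - {x}))))"
      unfolding eq using Suc.prems fin by (intro card_UN_disjoint) auto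
    also have "\<dots> = (\<Sum>x\<in>S. card (L S) + card (L (S - {x})))"
    proof (rule sum.cong)
      fix x assume "x \<in> S"
      \<comment> \<open>The two kinds of remainder differ in whether \<open>x\<close>
        occurs.\<close>
      then have "L S \<inter> L (S - {x}) = {}" by (auto simp: L_def)
      then show "card ((#) x ` (L S \<union> L (S - {x}))) = card (L S) + card (L (S - {x}))"
        using Suc.prems fin by (simp add: card_image card_Un_disjoint)
    qed simp
    also have "\<dots> = (\<Sum>x\<in>S. fact (Suc k) * Stirling n (Suc k) + fact k * Stirling n k)"
      using Suc.prems c by (intro sum.cong) (simp_all add: L_def Suc.IH)
    also have "\<dots> = fact (Suc k) * Stirling (Suc n) (Suc k)"
      using c by (simp add: algebra_simps)
    finally show ?thesis by (simp only: c)
  qed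
qed

text \<open>Absorbing one factor \<open>r - i\<close> into the binomial coefficient pulls out a
  factor \<open>r\<close>, and Pascal's rule splits what remains into the two terms of the Stirling
  recurrence. The range includes \<open>i = r\<close>, whose power is \<open>0 ^ n\<close>; this
  makes the formula correct for \<open>n = 0\<close> as well.\<close>

lemma Stirling_alternating_sum:
  "(\<Sum>i\<le>r. (-1) ^ i * int (r choose i) * (int r - int i) ^ n) = fact r * int (Stirling n r)"
proof (induction n arbitrary: r)
  case 0
  show ?case
    \<comment> \<open>All powers are 1, including \<open>0 ^ 0\<close>, so the sum expands
      \<open>(1 - 1) ^ r\<close>.\<close>
    using choose_alternating_sum[of r, where 'a = int] by (cases r) simp_all
next
  case (Suc n)
  define T where "T m k = (\<Sum>i\<le>k. (-1) ^ i * int (k choose i) * (int k - int i) ^ m)" for m k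
  show ?case
  proof (cases r)
    case (Suc k)
    have absorb: "int (Suc k choose i) * (int (Suc k) - int i) = int (Suc k) * int (k choose i)"
      if "i \<le> Suc k" for i
    proof -
      have "Suc k * (k choose i) = (Suc k choose i) * (Suc k - i)"
        using binomial_absorb_comp[of "Suc k" i] by (simp add: mult.commute)
      then show ?thesis using that by (metis of_nat_mult of_nat_diff)
    qed
    have "T (Suc n) (Suc k) = (\<Sum>i\<le>Suc k.
        (-1) ^ i * (int (Suc k choose i) * (int (Suc k) - int i)) * (int (Suc k) - int i) ^ n)"
      by (simp add: T_def mult_ac)
    also have "\<dots> = (\<Sum>i\<le>Suc k. (-1) ^ i * (int (Suc k) * int (k choose i)) * (int (Suc k) - int i) ^ n)"
      by (intro sum.cong) (simp_all only: absorb atMost_iff)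
    also have "\<dots> = int (Suc k) * (\<Sum>i\<le>Suc k. (-1) ^ i * int (k choose i) * (int (Suc k) - int i) ^ n)"
      by (simp only: sum_distrib_left mult_ac)
    \<comment> \<open>Pascal's rule in \<open>T n (Suc k)\<close> yields the left-hand sum plus a
      sum over \<open>k choose (i - 1)\<close>. Shifting the index of the latter flips the sign and
      gives \<open>- T n k\<close>.\<close>
    also have "(\<Sum>i\<le>Suc k. (-1) ^ i * int (k choose i) * (int (Suc k) - int i) ^ n)
        = T n (Suc k) + T n k"
      unfolding T_def sum.atMost_Suc_shift by (simp add: algebra_simps sum.distrib sum_negf sum_subtractf)
    also have "int (Suc k) * (T n (Suc k) + T n k) = fact (Suc k) * int (Stirling (Suc n) (Suc k))"
    proof -
      have "T n j = fact j * int (Stirling n j)" for j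
        unfolding T_def by (rule Suc.IH)
      then show ?thesis by (simp add: algebra_simps)
    qed
    finally show ?thesis
      by (simp only: T_def Suc)
  qed simp
qed

section \<open>Words with prescribed letter counts\<close>

text \<open>Such words are exactly the arrangements of one multiset, so their number is a
  multinomial coefficient.\<close>

lemma card_lists_count_list_eq:
  assumes S: "finite S" and n: "sum c S = n"
  shows "real (card {w. set w \<subseteq> S \<and> length w = n \<and> (\<forall>x\<in>S. count_list w x = c x)})
    = fact n / (\<Prod>x\<in>S. fact (c x))"
proof -
  define M where "M = (\<Sum>x\<in>S. replicate_mset (c x) x)"
  have count: "count M x = (if x \<in> S then c x else 0)" for x
    using S by (simp add: M_def count_sum)
  have "mset w = M \<longleftrightarrow> set w \<subseteq> S \<and> (\<forall>x\<in>S. count_list w x = c x)" for w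
    by (auto simp: multiset_eq_iff count count_mset count_list_0_iff split: if_splits)
  \<comment> \<open>The prescribed counts add up to \<open>n\<close>, so every arrangement of
    \<open>M\<close> has the right length.\<close>
  moreover have "length w = n" if "set w \<subseteq> S" "\<forall>x\<in>S. count_list w x = c x" for w
    using sum_count_set[OF that(1) S] that(2) n by simp
  ultimately have eq: "{w. set w \<subseteq> S \<and> length w = n \<and> (\<forall>x\<in>S. count_list w x = c x)}
      = permutations_of_multiset M"
    by (auto simp: permutations_of_multiset_def)
  have size: "size M = n"
    by (simp add: M_def n size_multiset_sum)
  have sub: "set_mset M \<subseteq> S"
    using count by (auto simp flip: count_greater_zero_iff split: if_splits)
  \<comment> \<open>Letters of \<open>S\<close> with count 0 are missing from \<open>M\<close>; each
    contributes the factor \<open>0! = 1\<close>.\<close>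
  have "(\<Prod>x\<in>set_mset M. fact (count M x)) = (\<Prod>x\<in>S. fact (c x) :: nat)"
  proof (rule prod.mono_neutral_cong_left)
    show "\<forall>x\<in>S - set_mset M. fact (c x) = (1 :: nat)"
      using count by (auto simp: not_in_iff)
  qed (use S sub count in auto)
  then have "card (permutations_of_multiset M) * (\<Prod>x\<in>S. fact (c x)) = fact n"
    using card_permutations_of_multiset_aux[of M] size by simp
  from arg_cong[OF this, of real]
  have "real (card (permutations_of_multiset M)) * (\<Prod>x\<in>S. fact (c x)) = fact n"
    by simp
  then show ?thesis
    unfolding eq using S by (simp add: eq_divide_eq)
qed

section \<open>The three cardinalities\<close>

lemma card_grl_vectors:
  assumes "inj_on As {1..r}"
  shows "card (grl_vectors r As n) = r ^ n"
  using bij_betw_same_card[OF bij_betw_expand_runs[OF assms, of n "\<lambda>_. True"]] assms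
  by (simp add: card_lists_length_eq card_image)

lemma card_surjective_grl_vectors:
  assumes "inj_on As {1..r}"
  shows "card (surjective_grl_vectors r As n) = fact r * Stirling n r"
proof -
  have pos: "1 \<le> count_list w x \<longleftrightarrow> x \<in> set w" for w :: "'a set list" and x
    using count_list_0_iff[of w x] by linarith
  have "card (surjective_grl_vectors r As n) =
      card {w. set w \<subseteq> As ` {1..r} \<and> length w = n \<and> (\<forall>i\<in>{1..r}. 1 \<le> count_list w (As i))}"
    unfolding surjective_grl_vectors_def
    using bij_betw_same_card[OF bij_betw_expand_runs[OF assms, of n "\<lambda>c. \<forall>i\<in>{1..r}. 1 \<le> c (As i)"]] .
  also have "{w. set w \<subseteq> As ` {1..r} \<and> length w = n \<and> (\<forall>i\<in>{1..r}. 1 \<le> count_list w (As i))}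
      = {w. length w = n \<and> set w = As ` {1..r}}"
    unfolding pos by blast
  finally show ?thesis
    using assms by (simp add: card_lists_set_eq card_image)
qed

lemma card_balanced_grl_vectors:
  assumes inj: "inj_on As {1..r}" and n: "n = q * r + s" and "s < r"
  shows "real (card (balanced_grl_vectors r As n q s))
    = real (r choose s) * (fact n / (fact (q + 1) ^ s * fact q ^ (r - s)))"
proof -
  define c where "c I i = (if i \<in> I then q + 1 else q)" for I and i :: nat
  define L where "L I = {w. set w \<subseteq> As ` {1..r} \<and> length w = n \<and>
      (\<forall>i\<in>{1..r}. count_list w (As i) = c I i)}" for I
  define \<I> where "\<I> = {I. I \<subseteq> {1..r} \<and> card I = s}"
  have "finite \<I>" by (simp add: \<I>_def)
  have card_L: "real (card (L I)) = fact n / (fact (q + 1) ^ s * fact q ^ (r - s))"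
    if "I \<in> \<I>" for I
  proof -
    have I: "I \<subseteq> {1..r}" "card I = s" "finite I"
      using that finite_subset by (auto simp: \<I>_def)
    \<comment> \<open>\<open>c I\<close> prescribes counts by index; \<open>d\<close> carries this
      over to the letters, as the multinomial count requires.\<close>
    define d where "d B = c I (inv_into {1..r} As B)" for B
    have d: "d (As i) = c I i" if "i \<in> {1..r}" for i
      using inv_into_f_f[OF inj that] by (simp add: d_def)
    have split: "{1..r} \<inter> I = I" "card ({1..r} - I) = r - s"
      using I by (auto simp: card_Diff_subset)
    have "sum (c I) {1..r} = q * r + card I"
    proof -
      have "sum (c I) {1..r} = (\<Sum>i\<in>{1..r}. q + (if i \<in> I then 1 else 0))"
        by (rule sum.cong) (simp_all add: c_def)
      also have "\<dots> = q * r + card ({1..r} \<inter> I)"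
        unfolding sum.distrib by (simp add: sum.If_cases)
      finally show ?thesis by (simp only: split)
    qed
    then have "sum d (As ` {1..r}) = n"
      using I n by (simp add: sum.reindex[OF inj] d del: One_nat_def)
    then have "real (card {w. set w \<subseteq> As ` {1..r} \<and> length w = n \<and>
        (\<forall>x\<in>As ` {1..r}. count_list w x = d x)}) = fact n / (\<Prod>x\<in>As ` {1..r}. fact (d x))"
      by (intro card_lists_count_list_eq) simp_all
    also have "{w. set w \<subseteq> As ` {1..r} \<and> length w = n \<and>
        (\<forall>x\<in>As ` {1..r}. count_list w x = d x)} = L I"
      by (auto simp: L_def d)
    also have "(\<Prod>x\<in>As ` {1..r}. fact (d x)) = (\<Prod>i\<in>{1..r}. fact (c I i) :: real)"
      by (simp add: prod.reindex[OF inj] d del: One_nat_def)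
    also have "\<dots> = (\<Prod>i\<in>{1..r} - I. fact (c I i)) * (\<Prod>i\<in>I. fact (c I i))"
      using I by (intro prod.subset_diff) auto
    also have "\<dots> = fact (q + 1) ^ s * fact q ^ (r - s)"
      using I split by (simp add: c_def)
    finally show ?thesis .
  qed
  have counts: "(\<forall>i\<in>I. count_list w (As i) = q + 1) \<and> (\<forall>i\<in>{1..r} - I. count_list w (As i) = q)
      \<longleftrightarrow> (\<forall>i\<in>{1..r}. count_list w (As i) = c I i)" if "I \<subseteq> {1..r}" for I w
  proof -
    have "{1..r} = I \<union> ({1..r} - I)"
      using that by blast
    then have "(\<forall>i\<in>{1..r}. count_list w (As i) = c I i)
        \<longleftrightarrow> (\<forall>i\<in>I. count_list w (As i) = c I i) \<and> (\<forall>i\<in>{1..r} - I. count_list w (As i) = c I i)"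
      by blast
    then show ?thesis
      by (simp add: c_def)
  qed
  have "card (balanced_grl_vectors r As n q s) = card {w. set w \<subseteq> As ` {1..r} \<and> length w = n \<and>
      (\<exists>I\<subseteq>{1..r}. card I = s \<and> (\<forall>i\<in>I. count_list w (As i) = q + 1) \<and>
        (\<forall>i\<in>{1..r} - I. count_list w (As i) = q))}"
    unfolding balanced_grl_vectors_def
    using bij_betw_same_card[OF bij_betw_expand_runs[OF inj, of n
      "\<lambda>c. \<exists>I\<subseteq>{1..r}. card I = s \<and> (\<forall>i\<in>I. c (As i) = q + 1) \<and> (\<forall>i\<in>{1..r} - I. c (As i) = q)"]] .
  also have "{w. set w \<subseteq> As ` {1..r} \<and> length w = n \<and>
      (\<exists>I\<subseteq>{1..r}. card I = s \<and> (\<forall>i\<in>I. count_list w (As i) = q + 1) \<and>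
        (\<forall>i\<in>{1..r} - I. count_list w (As i) = q))} = (\<Union>I\<in>\<I>. L I)"
    (is "?W = _")
  proof (rule set_eqI)
    fix w
    have "w \<in> ?W \<longleftrightarrow> set w \<subseteq> As ` {1..r} \<and> length w = n \<and>
        (\<exists>I\<in>\<I>. (\<forall>i\<in>I. count_list w (As i) = q + 1) \<and> (\<forall>i\<in>{1..r} - I. count_list w (As i) = q))"
      unfolding \<I>_def by blast
    also have "\<dots> \<longleftrightarrow> set w \<subseteq> As ` {1..r} \<and> length w = n \<and>
        (\<exists>I\<in>\<I>. \<forall>i\<in>{1..r}. count_list w (As i) = c I i)"
      by (intro conj_cong bex_cong refl counts) (simp add: \<I>_def)
    also have "\<dots> \<longleftrightarrow> w \<in> (\<Union>I\<in>\<I>. L I)"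
      unfolding L_def by blast
    finally show "w \<in> ?W \<longleftrightarrow> w \<in> (\<Union>I\<in>\<I>. L I)" .
  qed
  also have "card (\<Union>I\<in>\<I>. L I) = (\<Sum>I\<in>\<I>. card (L I))"
  proof (intro card_UN_disjoint ballI impI)
    fix I assume "I \<in> \<I>"
    show "finite (L I)"
      by (rule finite_subset[OF _ finite_lists_length_eq[of "As ` {1..r}" n]]) (auto simp: L_def)
  next
    \<comment> \<open>A word determines its set \<open>I\<close> of letters used
      \<open>q + 1\<close> times, so different choices of \<open>I\<close> give disjoint sets of
      words.\<close>
    have "I = {i \<in> {1..r}. count_list w (As i) = q + 1}" if "w \<in> L I" "I \<in> \<I>" for w I
    proof -
      have "count_list w (As i) = q + 1 \<longleftrightarrow> i \<in> I" if "i \<in> {1..r}" for i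
        using \<open>w \<in> L I\<close> that by (simp add: L_def c_def)
      then show ?thesis
        using \<open>I \<in> \<I>\<close> unfolding \<I>_def by blast
    qed
    then show "L I \<inter> L J = {}" if "I \<in> \<I>" "J \<in> \<I>" "I \<noteq> J" for I J
      using that by blast
  qed fact
  finally show ?thesis
    using n_subsets[of "{1..r}" s] by (simp add: card_L flip: \<I>_def del: One_nat_def)
qed

theorem theorem4p1:
  fixes n r :: nat and A :: "'a set" and As :: "nat \<Rightarrow> 'a set"
  assumes "1 \<le> r" and "r \<le> n"
    and "complete_partitioned_alphabet A r As"
  shows "card (grl_vectors r As n) = r ^ n
    \<and> int (card (surjective_grl_vectors r As n))
        = (\<Sum>i=0..r-1. (- 1) ^ i * int (r choose i) * (int r - int i) ^ n)
    \<and> (\<Sum>i=0..r-1. (- 1) ^ i * int (r choose i) * (int r - int i) ^ n)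
        = fact r * int (Stirling n r)
    \<and> (\<forall>q s. q = n div r \<longrightarrow> n = q * r + s \<longrightarrow> s < r \<longrightarrow>
         real (card (balanced_grl_vectors r As n q s))
           = real (r choose s) * (fact n / (fact (q + 1) ^ s * fact q ^ (r - s))))
    \<and> (r dvd n \<longrightarrow>
         real (card (balanced_grl_vectors r As n (n div r) 0)) = fact n / fact (n div r) ^ r)"
proof -
  \<comment> \<open>If \<open>As i = As j\<close> with \<open>i\<close> and \<open>j\<close>
    distinct, disjointness would make \<open>As i\<close> empty.\<close>
  have inj: "inj_on As {1..r}"
    using assms(3)
    unfolding complete_partitioned_alphabet_def partitioned_alphabet_def disjoint_family_on_def
    by (intro inj_onI) (metis inf.idem)
  \<comment> \<open>The term \<open>i = r\<close>, absent here, is a multiple of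
    \<open>0 ^ n\<close>, which vanishes because \<open>n\<close> is positive.\<close>
  have alternating: "(\<Sum>i=0..r-1. (- 1) ^ i * int (r choose i) * (int r - int i) ^ n)
      = fact r * int (Stirling n r)"
    unfolding Stirling_alternating_sum[symmetric]
    by (rule sum.mono_neutral_left) (use assms(1,2) in auto)
  have "real (card (balanced_grl_vectors r As n (n div r) 0)) = fact n / fact (n div r) ^ r"
    if "r dvd n"
    using card_balanced_grl_vectors[OF inj, of n "n div r" 0] that assms(1) by simp
  moreover have "int (card (surjective_grl_vectors r As n))
      = (\<Sum>i=0..r-1. (- 1) ^ i * int (r choose i) * (int r - int i) ^ n)"
    unfolding alternating card_surjective_grl_vectors[OF inj] by simp
  ultimately show ?thesis
    using card_grl_vectors[OF inj] alternating card_balanced_grl_vectors[OF inj] by blast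
qed

end
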